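(* Let $(S,V)$ be as in the context and let $T$ be any ideal triangulation of $(S,V)$ without trapped edges. Then $T$ is inversive, meaning the following. If $S$ is orientable, or non-orientable with $\chi(S)$ even and strictly negative, then any two branchings $b,b'$ on $T$ are connected by a finite sequence of inversions of untrapped ambiguous edges. If $S$ is non-orientable with $\chi(S)=0$ or $\chi(S)$ odd, then for any two branchings $b,b'$ on $T$, either $b$ and $b'$, or $-b$ and $b'$, are connected by such a sequence.
   Context: $S$ is a compact closed connected surface and $V\subset S$ is a finite set of $n$ marked points with $\chi(S)-n<0$. An ideal triangulation of $(S,V)$ is a possibly loose triangulation of $S$ with vertex set exactly $V$, viewed as obtained by gluing abstract triangles along their abstract edges in pairs. A branching $b$ is an orientation of all edges which on each abstract triangle is induced by a total order of its vertices, edges pointing to the larger endpoint. $-b$ denotes the complete reversal. An edge is trapped if it results from the identification of two edges of a single abstract triangle, and untrapped otherwise. An edge $e$ is ambiguous in $(T,b)$ if reversing the orientation of $e$ alone yields again a branching. Inverting it means passing to that branching. *)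

theory Defs
  imports Main
begin

text \<open>Combinatorial model of an ideal triangulation obtained by gluing finitely many
abstract triangles along their abstract edges in pairs.
Abstract triangles are indexed by a finite set F; the corners of triangle t are
(t,0), (t,1), (t,2); a directed abstract edge is (t,a,b) with a, b < 3, a \<noteq> b.
The gluing is an involution sigma on directed abstract edges, compatible with reversal,
which identifies the abstract edge (t,a,b) with sigma (t,a,b) = (t',a',b'),
corner a going to corner a' and corner b going to corner b'.\<close>

type_synonym 't dedge = "'t \<times> nat \<times> nat"

definition dedges :: "'t set \<Rightarrow> 't dedge set" where
  "dedges F = {(t, a, b). t \<in> F \<and> a < 3 \<and> b < 3 \<and> a \<noteq> b}"

definition rev_de :: "'t dedge \<Rightarrow> 't dedge" where
  "rev_de = (\<lambda>(t, a, b). (t, b, a))"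

definition is_gluing :: "'t set \<Rightarrow> ('t dedge \<Rightarrow> 't dedge) \<Rightarrow> bool" where
  "is_gluing F \<sigma> \<longleftrightarrow>
     (\<forall>d\<in>dedges F. \<sigma> d \<in> dedges F \<and> \<sigma> (\<sigma> d) = d \<and> \<sigma> (rev_de d) = rev_de (\<sigma> d)
        \<and> \<sigma> d \<noteq> d \<and> \<sigma> d \<noteq> rev_de d)"

text \<open>Connectedness of S: the dual graph of the gluing is connected.\<close>
definition dual_adj :: "'t set \<Rightarrow> ('t dedge \<Rightarrow> 't dedge) \<Rightarrow> 't \<Rightarrow> 't \<Rightarrow> bool" where
  "dual_adj F \<sigma> t t' \<longleftrightarrow> (\<exists>d\<in>dedges F. fst d = t \<and> fst (\<sigma> d) = t')"

definition glued_connected :: "'t set \<Rightarrow> ('t dedge \<Rightarrow> 't dedge) \<Rightarrow> bool" where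
  "glued_connected F \<sigma> \<longleftrightarrow> (\<forall>t\<in>F. \<forall>t'\<in>F. (dual_adj F \<sigma>)\<^sup>*\<^sup>* t t')"

text \<open>Edges of T: classes of directed abstract edges under reversal and gluing.\<close>
definition edge_class :: "('t dedge \<Rightarrow> 't dedge) \<Rightarrow> 't dedge \<Rightarrow> 't dedge set" where
  "edge_class \<sigma> d = {d, rev_de d, \<sigma> d, rev_de (\<sigma> d)}"

definition tri_edges :: "'t set \<Rightarrow> ('t dedge \<Rightarrow> 't dedge) \<Rightarrow> 't dedge set set" where
  "tri_edges F \<sigma> = edge_class \<sigma> ` dedges F"

text \<open>Vertices of T (= the marked points V): classes of corners under the identification
induced by the gluing.\<close>
definition corners :: "'t set \<Rightarrow> ('t \<times> nat) set" where
  "corners F = {(t, a). t \<in> F \<and> a < 3}"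

definition corner_rel :: "'t set \<Rightarrow> ('t dedge \<Rightarrow> 't dedge) \<Rightarrow> (('t \<times> nat) \<times> ('t \<times> nat)) set" where
  "corner_rel F \<sigma> = {((t, a), (fst (\<sigma> (t, a, b)), fst (snd (\<sigma> (t, a, b)))) ) | t a b. (t, a, b) \<in> dedges F}"

definition tri_vertices :: "'t set \<Rightarrow> ('t dedge \<Rightarrow> 't dedge) \<Rightarrow> ('t \<times> nat) set set" where
  "tri_vertices F \<sigma> = corners F // ((corner_rel F \<sigma>)\<^sup>*)"

text \<open>Euler characteristic of the glued surface S: #vertices - #edges + #triangles.\<close>
definition euler_char :: "'t set \<Rightarrow> ('t dedge \<Rightarrow> 't dedge) \<Rightarrow> int" where
  "euler_char F \<sigma> = int (card (tri_vertices F \<sigma>)) - int (card (tri_edges F \<sigma>)) + int (card F)"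

text \<open>Orientability: the triangles can be oriented so that glued edges receive opposite
induced orientations. With orientation bit True on t, the directed edge (t,a,b) agrees with
the orientation of t iff b = a+1 mod 3.\<close>
definition agrees :: "('t \<Rightarrow> bool) \<Rightarrow> 't dedge \<Rightarrow> bool" where
  "agrees \<epsilon> = (\<lambda>(t, a, b). (\<epsilon> t \<longleftrightarrow> b = (a + 1) mod 3))"

definition glued_orientable :: "'t set \<Rightarrow> ('t dedge \<Rightarrow> 't dedge) \<Rightarrow> bool" where
  "glued_orientable F \<sigma> \<longleftrightarrow> (\<exists>\<epsilon>. \<forall>d\<in>dedges F. agrees \<epsilon> d \<noteq> agrees \<epsilon> (\<sigma> d))"

text \<open>Trapped edge: it arises by identifying two abstract edges of one abstract triangle.\<close>
definition trapped :: "'t set \<Rightarrow> ('t dedge \<Rightarrow> 't dedge) \<Rightarrow> 't dedge set \<Rightarrow> bool" where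
  "trapped F \<sigma> e \<longleftrightarrow> (\<exists>d\<in>e. d \<in> dedges F \<and> fst (\<sigma> d) = fst d)"

text \<open>An orientation of all edges is encoded by the set B of directed abstract edges
pointing in the chosen direction. It is a branching if it is compatible with the gluing
and on each abstract triangle it is induced by a total order of its vertices.\<close>
definition branching :: "'t set \<Rightarrow> ('t dedge \<Rightarrow> 't dedge) \<Rightarrow> 't dedge set \<Rightarrow> bool" where
  "branching F \<sigma> B \<longleftrightarrow> B \<subseteq> dedges F \<and>
     (\<forall>d\<in>dedges F. (d \<in> B \<longleftrightarrow> rev_de d \<notin> B) \<and> (d \<in> B \<longleftrightarrow> \<sigma> d \<in> B)) \<and>
     (\<forall>t\<in>F. \<exists>r :: nat \<Rightarrow> nat. \<forall>a<3. \<forall>b<3. a \<noteq> b \<longrightarrow> ((t, a, b) \<in> B \<longleftrightarrow> r a < r b))"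

text \<open>Complete reversal -b.\<close>
definition neg_branching :: "'t set \<Rightarrow> 't dedge set \<Rightarrow> 't dedge set" where
  "neg_branching F B = dedges F - B"

text \<open>Reversing the orientation of the single edge e.\<close>
definition reverse_edge :: "'t dedge set \<Rightarrow> 't dedge set \<Rightarrow> 't dedge set" where
  "reverse_edge B e = (B - e) \<union> (e - B)"

definition ambiguous :: "'t set \<Rightarrow> ('t dedge \<Rightarrow> 't dedge) \<Rightarrow> 't dedge set \<Rightarrow> 't dedge set \<Rightarrow> bool" where
  "ambiguous F \<sigma> B e \<longleftrightarrow> e \<in> tri_edges F \<sigma> \<and> branching F \<sigma> (reverse_edge B e)"

text \<open>One inversion of an untrapped ambiguous edge.\<close>
definition inversion_step :: "'t set \<Rightarrow> ('t dedge \<Rightarrow> 't dedge) \<Rightarrow> 't dedge set \<Rightarrow> 't dedge set \<Rightarrow> bool" where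
  "inversion_step F \<sigma> B B' \<longleftrightarrow>
     (\<exists>e\<in>tri_edges F \<sigma>. \<not> trapped F \<sigma> e \<and> ambiguous F \<sigma> B e \<and> B' = reverse_edge B e)"

definition inversion_connected :: "'t set \<Rightarrow> ('t dedge \<Rightarrow> 't dedge) \<Rightarrow> 't dedge set \<Rightarrow> 't dedge set \<Rightarrow> bool" where
  "inversion_connected F \<sigma> = (inversion_step F \<sigma>)\<^sup>*\<^sup>*"

end

theory Submission
  imports Defs
begin

text \<open>In a branched triangle exactly one edge, from the smallest to the largest corner,
  cannot be reversed; call it special. An untrapped edge is ambiguous iff it is special on neither
  side, and inverting it makes special, on each side, the edge that is neither inverted nor
  special before. Among the branchings reachable from b and from b' take two differing in a set D
  of edges as small as possible. If D is nonempty, no edge of D is ambiguous, and a count shows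
  that D is a union of cycles in the dual cubic graph and that each of its edges is special on
  exactly one side. By another count, some sequence of inversions reaches an edge at a triangle
  met by D; performed on both branchings, it keeps D but makes an edge of D ambiguous,
  contradicting minimality. The only exception is a pair of triangles glued along all three edges;
  then -b and b' differ in a single edge, the surface has nonnegative Euler characteristic, and it
  is non-orientable because in the orientable case the two special edges agree.\<close>

section \<open>Reconfiguration on signed cubic graphs\<close>

text \<open>The vertices of the graph are the triangles, the half-edges at t are the pairs (t, i) with
  i < 3, and P h tells whether the chosen directions of the half-edges h and \<open>\<tau> h\<close> agree under the
  gluing.\<close>

locale signed_cubic_graph =
  fixes F :: "'t set" and \<tau> :: "'t \<times> nat \<Rightarrow> 't \<times> nat" and P :: "'t \<times> nat \<Rightarrow> bool"
  assumes finite_F: "finite F"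
    and tau_in: "h \<in> F \<times> {..<3} \<Longrightarrow> \<tau> h \<in> F \<times> {..<3}"
    and tau_tau: "h \<in> F \<times> {..<3} \<Longrightarrow> \<tau> (\<tau> h) = h"
    and no_loop: "h \<in> F \<times> {..<3} \<Longrightarrow> fst (\<tau> h) \<noteq> fst h"
    and connected: "Z \<subseteq> F \<Longrightarrow> Z \<noteq> {} \<Longrightarrow>
      (\<And>h. h \<in> F \<times> {..<3} \<Longrightarrow> fst h \<in> Z \<Longrightarrow> fst (\<tau> h) \<in> Z) \<Longrightarrow> Z = F"
begin

section \<open>States, flips and special half-edges\<close>

definition H :: "('t \<times> nat) set" where
  "H = F \<times> {..<3}"

text \<open>Membership in \<open>X\<close> is one bit per half-edge. The condition on
  \<open>P\<close> is compatibility with the gluing; the last one excludes the two cyclic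
  orientations of a triangle, where all three bits are equal.\<close>

definition state :: "('t \<times> nat) set \<Rightarrow> bool" where
  "state X \<longleftrightarrow> X \<subseteq> H \<and> (\<forall>h\<in>H. (h \<in> X \<longleftrightarrow> \<tau> h \<in> X) \<longleftrightarrow> P h) \<and>
     (\<forall>t\<in>F. \<exists>h\<in>H. \<exists>k\<in>H. fst h = t \<and> fst k = t \<and> h \<in> X \<and> k \<notin> X)"

definition flip :: "('t \<times> nat) set \<Rightarrow> 't \<times> nat \<Rightarrow> ('t \<times> nat) set" where
  "flip X h = {k. (k \<in> X) \<noteq> (k = h \<or> k = \<tau> h)}"

definition step :: "('t \<times> nat) set \<Rightarrow> ('t \<times> nat) set \<Rightarrow> bool" where
  "step X Y \<longleftrightarrow> state X \<and> state Y \<and> (\<exists>h\<in>H. Y = flip X h)"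

definition diff :: "('t \<times> nat) set \<Rightarrow> ('t \<times> nat) set \<Rightarrow> ('t \<times> nat) set" where
  "diff X Y = {k. (k \<in> X) \<noteq> (k \<in> Y)}"

text \<open>With cyclic reference directions, the edge from the smallest to the largest corner is
  the one whose bit is in the minority.\<close>

definition special :: "('t \<times> nat) set \<Rightarrow> 't \<times> nat \<Rightarrow> bool" where
  "special X h \<longleftrightarrow> h \<in> H \<and> (\<forall>k\<in>H. fst k = fst h \<longrightarrow> k \<noteq> h \<longrightarrow> (k \<in> X) \<noteq> (h \<in> X))"

lemma finite_H: "finite H"
  by (simp add: H_def finite_F)

lemma tau_H [simp]: "h \<in> H \<Longrightarrow> \<tau> h \<in> H"
  using tau_in by (simp add: H_def)

lemma tau_tau_H [simp]: "h \<in> H \<Longrightarrow> \<tau> (\<tau> h) = h"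
  using tau_tau by (simp add: H_def)

lemma fst_tau_H [simp]: "h \<in> H \<Longrightarrow> fst (\<tau> h) \<noteq> fst h"
  using no_loop by (simp add: H_def)

lemma fst_H: "h \<in> H \<Longrightarrow> fst h \<in> F"
  by (auto simp: H_def)

lemma inj_tau: "inj_on \<tau> H"
  by (metis inj_onI tau_tau_H)

lemma fiber:
  assumes "h \<in> H"
  obtains k l where "k \<in> H" "l \<in> H" "fst k = fst h" "fst l = fst h" "k \<noteq> h" "l \<noteq> h" "k \<noteq> l"
    "\<And>m. m \<in> H \<Longrightarrow> fst m = fst h \<Longrightarrow> m = h \<or> m = k \<or> m = l"
proof -
  obtain t i where h: "h = (t, i)" "t \<in> F" "i < 3"
    using assms by (auto simp: H_def)
  define j where "j = (i + 1) mod 3"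
  define l where "l = (i + 2) mod 3"
  have "i = 0 \<or> i = 1 \<or> i = 2" using h by auto
  then have "(i, j, l) \<in> {(0, 1, 2), (1, 2, 0), (2, 0, 1)}"
    unfolding j_def l_def by (elim disjE) simp_all
  then have "j < 3" "l < 3" "j \<noteq> i" "l \<noteq> i" "j \<noteq> l" "\<And>m. m < 3 \<Longrightarrow> m = i \<or> m = j \<or> m = l"
    by auto
  then show ?thesis
    using h by (intro that [of "(t, j)" "(t, l)"]) (auto simp: H_def)
qed

lemma flip_tau: "h \<in> H \<Longrightarrow> flip X (\<tau> h) = flip X h"
  by (auto simp: flip_def)

lemma flip_flip: "flip (flip X h) h = X"
  by (auto simp: flip_def)

lemma step_flip: "state X \<Longrightarrow> h \<in> H \<Longrightarrow> state (flip X h) \<Longrightarrow> step X (flip X h)"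
  by (auto simp: step_def)

lemma step_sym: "step X Y \<Longrightarrow> step Y X"
  by (metis flip_flip step_def)

lemma steps_sym: "step\<^sup>*\<^sup>* X Y \<Longrightarrow> step\<^sup>*\<^sup>* Y X"
  by (induction rule: rtranclp_induct) (auto intro: step_sym converse_rtranclp_into_rtranclp)

lemma steps_state: "step\<^sup>*\<^sup>* X Y \<Longrightarrow> state X \<Longrightarrow> state Y"
  by (induction rule: rtranclp_induct) (auto simp: step_def)

text \<open>Two distinct special half-edges at a triangle would carry different bits, and the third
  bit would have to differ from both.\<close>

lemma special_unique:
  assumes "special X h" "special X k" "fst h = fst k"
  shows "h = k"
proof (rule ccontr)
  assume "h \<noteq> k"
  have "h \<in> H" using assms by (simp add: special_def)
  then obtain a b where "a \<in> H" "b \<in> H" "fst a = fst h" "fst b = fst h" "a \<noteq> h" "b \<noteq> h" "a \<noteq> b"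
    "\<And>m. m \<in> H \<Longrightarrow> fst m = fst h \<Longrightarrow> m = h \<or> m = a \<or> m = b"
    by (rule fiber) blast
  then show False
    using assms \<open>h \<noteq> k\<close> unfolding special_def by metis
qed

lemma special_exists:
  assumes "state X" "t \<in> F"
  obtains h where "special X h" "fst h = t"
proof -
  obtain h k where hk: "h \<in> H" "k \<in> H" "fst h = t" "fst k = t" "h \<in> X" "k \<notin> X"
    using assms unfolding state_def by blast
  obtain a b where "a \<in> H" "b \<in> H" "fst a = fst h" "fst b = fst h" "a \<noteq> h" "b \<noteq> h" "a \<noteq> b"
    and ab: "\<And>m. m \<in> H \<Longrightarrow> fst m = fst h \<Longrightarrow> m = h \<or> m = a \<or> m = b"
    using hk(1) by (rule fiber) blast
  then have "special X h \<or> special X a \<or> special X b"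
    using hk unfolding special_def by metis
  then show ?thesis
    using that hk \<open>fst a = fst h\<close> \<open>fst b = fst h\<close> by metis
qed

lemma special_flip_away:
  assumes "h \<in> H" "fst k \<noteq> fst h" "fst k \<noteq> fst (\<tau> h)"
  shows "special (flip X h) k \<longleftrightarrow> special X k"
  using assms unfolding special_def flip_def by auto

text \<open>The bits at the triangle are x, x, not x, and \<open>h\<close> carries one of the x.
  Once it is toggled, the other x is the minority; \<open>\<tau> h\<close> lies at another triangle
  and does not interfere.\<close>

lemma special_flip:
  assumes "state X" "h \<in> H" "\<not> special X h" "k \<in> H" "fst k = fst h"
  shows "special (flip X h) k \<longleftrightarrow> k \<noteq> h \<and> \<not> special X k"
proof -
  obtain a b where ab: "a \<in> H" "b \<in> H" "fst a = fst h" "fst b = fst h" "a \<noteq> h" "b \<noteq> h" "a \<noteq> b"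
    and all: "\<And>m. m \<in> H \<Longrightarrow> fst m = fst h \<Longrightarrow> m = h \<or> m = a \<or> m = b"
    using assms(2) by (rule fiber) blast
  have nt: "\<And>m. fst m = fst h \<Longrightarrow> m \<noteq> \<tau> h" using fst_tau_H [OF assms(2)] by auto
  have fl: "h \<in> flip X h \<longleftrightarrow> h \<notin> X" "a \<in> flip X h \<longleftrightarrow> a \<in> X" "b \<in> flip X h \<longleftrightarrow> b \<in> X"
    using ab nt by (auto simp: flip_def)
  have sp: "special Y h \<longleftrightarrow> (a \<in> Y) \<noteq> (h \<in> Y) \<and> (b \<in> Y) \<noteq> (h \<in> Y)"
    "special Y a \<longleftrightarrow> (h \<in> Y) \<noteq> (a \<in> Y) \<and> (b \<in> Y) \<noteq> (a \<in> Y)"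
    "special Y b \<longleftrightarrow> (h \<in> Y) \<noteq> (b \<in> Y) \<and> (a \<in> Y) \<noteq> (b \<in> Y)" for Y
    using ab all assms(2) unfolding special_def by metis+
  obtain s where "special X s" "fst s = fst h"
    using special_exists assms(1,2) fst_H by metis
  then have "special X a \<or> special X b"
    using assms(3) all special_def by metis
  note bool = this assms(3)
  consider "k = h" | "k = a" | "k = b" using all assms(4,5) by blast
  then show ?thesis
  proof cases
    case 1
    show ?thesis using bool ab unfolding 1 sp fl by blast
  next
    case 2
    show ?thesis using bool ab unfolding 2 sp fl by blast
  next
    case 3
    show ?thesis using bool ab unfolding 3 sp fl by blast
  qed
qed

lemma not_special_if_state_flip:
  assumes "state X" "h \<in> H" "state (flip X h)"
  shows "\<not> special X h"
proof
  assume sp: "special X h"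
  obtain a b where ab: "a \<in> H" "b \<in> H" "fst a = fst h" "fst b = fst h" "a \<in> flip X h" "b \<notin> flip X h"
    using assms fst_H unfolding state_def by metis
  have "m \<in> flip X h \<longleftrightarrow> h \<notin> X" if "m \<in> H" "fst m = fst h" for m
    using sp that fst_tau_H [OF assms(2)] unfolding special_def flip_def by auto
  then show False using ab by auto
qed

lemma state_flip:
  assumes X: "state X" and h: "h \<in> H" "\<not> special X h" "\<not> special X (\<tau> h)"
  shows "state (flip X h)"
proof -
  have 1: "\<exists>k\<in>H. \<exists>l\<in>H. fst k = t \<and> fst l = t \<and> k \<in> flip X h \<and> l \<notin> flip X h" if t: "t \<in> F" for t
  proof -
    have "\<exists>s. special (flip X h) s \<and> fst s = t"
    proof -
      \<comment> \<open>Of the two half-edges beside \<open>g\<close> at most one is special before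
        the flip, so one of them becomes special. This is applied to both ends of the edge.\<close>
      have main: "\<exists>s. special (flip X g) s \<and> fst s = fst g" if g: "g \<in> H" "\<not> special X g" for g
      proof -
        obtain a b where ab: "a \<in> H" "b \<in> H" "fst a = fst g" "fst b = fst g" "a \<noteq> g" "b \<noteq> g" "a \<noteq> b"
          using g(1) by (rule fiber) blast
        then have "\<not> special X a \<or> \<not> special X b" using special_unique by metis
        then show ?thesis using special_flip [OF X g] ab by metis
      qed
      obtain s where "special X s" "fst s = t" using special_exists X t by blast
      then show ?thesis
        using special_flip_away [OF h(1)] main [OF h(1,2)] main [OF tau_H [OF h(1)] h(3)]
          flip_tau [OF h(1)] by metis
    qed
    then obtain s where s: "special (flip X h) s" "fst s = t" by blast
    then have "s \<in> H" by (simp add: special_def)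
    then obtain a b where "a \<in> H" "b \<in> H" "fst a = fst s" "fst b = fst s" "a \<noteq> s"
      by (rule fiber) blast
    then show ?thesis using s \<open>s \<in> H\<close> unfolding special_def by metis
  qed
  \<comment> \<open>The toggled pair is closed under \<open>\<tau>\<close>, so agreement between the
    ends of any edge is unchanged.\<close>
  have 2: "(k \<in> flip X h \<longleftrightarrow> \<tau> k \<in> flip X h) \<longleftrightarrow> P k" if k: "k \<in> H" for k
  proof -
    have "(k = h \<or> k = \<tau> h) \<longleftrightarrow> (\<tau> k = h \<or> \<tau> k = \<tau> h)"
      using k h(1) tau_tau_H by metis
    moreover have "(k \<in> X \<longleftrightarrow> \<tau> k \<in> X) \<longleftrightarrow> P k" using X k by (auto simp: state_def)
    ultimately show ?thesis unfolding flip_def by auto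
  qed
  have "flip X h \<subseteq> H" using X h(1) by (auto simp: flip_def state_def)
  then show ?thesis using 1 2 by (auto simp: state_def)
qed

lemma state_flip_iff:
  assumes "state X" "h \<in> H"
  shows "state (flip X h) \<longleftrightarrow> \<not> special X h \<and> \<not> special X (\<tau> h)"
  using assms state_flip not_special_if_state_flip flip_tau tau_H by metis

text \<open>A non-special half-edge at a permanently frozen triangle is permanently special at its other
  end, which therefore is frozen too; so the two non-special half-edges of each frozen triangle
  inject into the one special half-edge per frozen triangle.\<close>

lemma eventually_flippable:
  assumes X: "state X" and t: "t \<in> F"
  obtains Y h where "step\<^sup>*\<^sup>* X Y" "h \<in> H" "fst h = t" "state (flip Y h)"
proof -
  define Z where "Z = {t\<in>F. \<forall>Y. step\<^sup>*\<^sup>* X Y \<longrightarrow> (\<forall>h\<in>H. fst h = t \<longrightarrow> \<not> state (flip Y h))}"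
  have const: "special Y h \<longleftrightarrow> special X h" if "step\<^sup>*\<^sup>* X Y" "fst h \<in> Z" for Y h
    using that(1)
  proof (induction rule: rtranclp_induct)
    case (step Y Y')
    then obtain k where k: "k \<in> H" "Y' = flip Y k" "state Y'" by (auto simp: step_def)
    moreover have "\<not> state (flip Y m)" if "m \<in> H" "fst m = fst h" for m
      using that \<open>fst h \<in> Z\<close> step.hyps unfolding Z_def by blast
    ultimately have "fst h \<noteq> fst k" "fst h \<noteq> fst (\<tau> k)"
      using flip_tau tau_H by metis+
    then show ?case using step.IH special_flip_away k by metis
  qed simp
  have propagate: "special X (\<tau> h) \<and> fst (\<tau> h) \<in> Z" if h: "h \<in> H" "fst h \<in> Z" "\<not> special X h" for h
  proof -
    have sp: "special Y (\<tau> h)" if Y: "step\<^sup>*\<^sup>* X Y" for Y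
      using const [OF Y h(2)] h state_flip_iff [OF steps_state [OF Y X] h(1)] Y
      unfolding Z_def by auto
    \<comment> \<open>A flip there would move the special half-edge away from
      \<open>\<tau> h\<close>, contradicting \<open>sp\<close> after the flip.\<close>
    moreover have "\<not> state (flip Y k)" if Y: "step\<^sup>*\<^sup>* X Y" and k: "k \<in> H" "fst k = fst (\<tau> h)" for Y k
    proof
      assume st: "state (flip Y k)"
      have sY: "state Y" using Y X steps_state by blast
      have "step\<^sup>*\<^sup>* X (flip Y k)"
        using Y step_flip [OF sY k(1) st] by (rule rtranclp.rtrancl_into_rtrancl)
      then have "special (flip Y k) (\<tau> h)" by (rule sp)
      moreover have "\<not> special Y k" using st sY k state_flip_iff by blast
      ultimately show False
        using special_flip [OF sY k(1)] k h(1) sp [OF Y] by auto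
    qed
    ultimately show ?thesis using h fst_H tau_H unfolding Z_def by auto
  qed
  define N where "N = {h\<in>H. fst h \<in> Z \<and> \<not> special X h}"
  define S where "S = {h\<in>H. fst h \<in> Z \<and> special X h}"
  have fin: "finite N" "finite S" "finite Z"
    using finite_H finite_F by (auto simp: N_def S_def Z_def)
  have "\<tau> ` N \<subseteq> S" using propagate by (auto simp: N_def S_def)
  moreover have "inj_on \<tau> N" using inj_tau by (rule inj_on_subset) (auto simp: N_def)
  ultimately have "card N \<le> card S" using card_inj_on_le fin by metis
  moreover have "inj_on fst S" by (rule inj_onI) (use special_unique S_def in blast)
  then have "card S \<le> card Z"
    using fin card_inj_on_le [of fst S Z] by (auto simp: S_def)
  moreover have "Z \<times> {..<3::nat} = N \<union> S"
    by (auto simp: N_def S_def H_def Z_def)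
  then have "card Z * 3 = card (N \<union> S)"
    using card_cartesian_product [of Z "{..<3::nat}"] by simp
  moreover have "card (N \<union> S) \<le> card N + card S" by (rule card_Un_le)
  \<comment> \<open>The counts give \<open>3 * card Z \<le> card N + card S \<le> 2 * card S \<le> 2
    * card Z\<close>.\<close>
  ultimately have "card Z = 0" by linarith
  then have "Z = {}" using fin by simp
  then show ?thesis using that t unfolding Z_def by blast
qed

section \<open>The difference of two states\<close>

lemma diff_subset: "state X \<Longrightarrow> state Y \<Longrightarrow> diff X Y \<subseteq> H"
  by (auto simp: state_def diff_def)

text \<open>\<open>P\<close> fixes whether the two ends of an edge carry equal bits, for
  \<open>X\<close> and \<open>Y\<close> alike, so a change at one end forces a change at the
  other.\<close>

lemma diff_tau:
  assumes "state X" "state Y" "h \<in> diff X Y"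
  shows "\<tau> h \<in> diff X Y"
proof -
  have "h \<in> H" using diff_subset assms by blast
  then have "(h \<in> X \<longleftrightarrow> \<tau> h \<in> X) \<longleftrightarrow> (h \<in> Y \<longleftrightarrow> \<tau> h \<in> Y)"
    using assms by (simp add: state_def)
  then show ?thesis using assms(3) by (auto simp: diff_def)
qed

lemma diff_tau_iff:
  assumes "state X" "state Y" "h \<in> H"
  shows "\<tau> h \<in> diff X Y \<longleftrightarrow> h \<in> diff X Y"
  using assms diff_tau tau_tau_H by metis

text \<open>Count non-special half-edges of the difference: they inject into the special ones by passing
  to the other end, and each special one has a non-special neighbour at its own triangle, so both
  injections are bijections.\<close>

lemma stuck:
  assumes X: "state X" and Y: "state Y"
    and stuck: "\<And>h. h \<in> diff X Y \<Longrightarrow> \<not> state (flip X h)"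
    and h: "h \<in> diff X Y"
  shows "special X h \<noteq> special X (\<tau> h)"
    and "\<exists>k\<in>diff X Y. fst k = fst h \<and> k \<noteq> h \<and> special X k \<noteq> special X h"
proof -
  define D where "D = diff X Y"
  have DH: "D \<subseteq> H" using diff_subset X Y by (simp add: D_def)
  define N where "N = {h\<in>D. \<not> special X h}"
  define S where "S = {h\<in>D. special X h}"
  have fin: "finite N" "finite S"
    using finite_H DH by (auto simp: N_def S_def intro: finite_subset)
  have "\<exists>k\<in>N. fst k = fst s" if s: "s \<in> S" for s
  proof (rule ccontr)
    assume no: "\<not> ?thesis"
    have sH: "s \<in> H" "special X s" "s \<in> D" using s DH by (auto simp: S_def)
    \<comment> \<open>Without such a neighbour, \<open>Y\<close> differs from \<open>X\<close> at
      this triangle only in the minority bit, so all its bits there would be equal.\<close>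
    have "(k \<in> Y) \<longleftrightarrow> (s \<in> Y)" if k: "k \<in> H" "fst k = fst s" for k
    proof (cases "k = s")
      case False
      then have "\<not> special X k" using special_unique sH k by metis
      then have "k \<notin> D" using no k unfolding N_def by blast
      then show ?thesis using sH k False by (auto simp: special_def D_def diff_def)
    qed simp
    then show False using Y fst_H [OF sH(1)] unfolding state_def by metis
  qed
  then obtain p where p: "\<And>s. s \<in> S \<Longrightarrow> p s \<in> N \<and> fst (p s) = fst s" by metis
  have injp: "inj_on p S"
    by (rule inj_onI) (metis (no_types, lifting) S_def mem_Collect_eq p special_unique)
  then have "card S \<le> card N"
    using p fin by (intro card_inj_on_le [of p]) auto
  moreover have tauN: "\<tau> ` N \<subseteq> S"
  proof
    fix k assume "k \<in> \<tau> ` N"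
    then obtain n where n: "n \<in> D" "\<not> special X n" "k = \<tau> n" by (auto simp: N_def)
    then have "special X k" using stuck state_flip [OF X] DH unfolding D_def by blast
    then show "k \<in> S" using n diff_tau X Y unfolding S_def D_def by blast
  qed
  moreover have injt: "inj_on \<tau> N" using inj_tau by (rule inj_on_subset) (use DH in \<open>auto simp: N_def\<close>)
  ultimately have "card N = card S" using fin card_inj_on_le le_antisym by metis
  \<comment> \<open>Injections between finite sets of equal size are onto: \<open>\<tau>\<close>
    pairs special with non-special half-edges along edges of \<open>D\<close>, and \<open>p\<close>
    pairs them within triangles.\<close>
  then have pS: "p ` S = N" and tN: "\<tau> ` N = S"
    using card_subset_eq fin tauN card_image injp injt p
    by (metis image_subsetI)+
  have hD: "h \<in> D" "h \<in> H" using h DH by (auto simp: D_def)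
  show "special X h \<noteq> special X (\<tau> h)"
  proof (cases "special X h")
    case True
    then have "h \<in> \<tau> ` N" using hD tN by (simp add: S_def)
    then show ?thesis using True DH by (auto simp: N_def)
  next
    case False
    then have "\<tau> h \<in> S" using hD tauN by (auto simp: N_def)
    then show ?thesis using False by (auto simp: S_def)
  qed
  have exS: "\<exists>s\<in>S. fst s = fst n" if "n \<in> N" for n
    using that pS p by (metis imageE)
  show "\<exists>k\<in>diff X Y. fst k = fst h \<and> k \<noteq> h \<and> special X k \<noteq> special X h"
  proof (cases "special X h")
    case True
    then have "p h \<in> N" "fst (p h) = fst h" using p hD by (auto simp: S_def)
    then show ?thesis using True by (intro bexI [of _ "p h"]) (auto simp: N_def D_def)
  next
    case False
    then have "h \<in> N" using hD by (simp add: N_def)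
    then obtain s where "s \<in> S" "fst s = fst h" using exS by blast
    then show ?thesis using False by (intro bexI [of _ s]) (auto simp: S_def D_def)
  qed
qed

lemma special_cong:
  assumes "\<And>k. k \<in> diff X Y \<Longrightarrow> fst k \<noteq> fst h"
  shows "special X h \<longleftrightarrow> special Y h"
  using assms unfolding special_def diff_def by fastforce

lemma diff_flip_flip: "diff (flip X h) (flip Y h) = diff X Y"
  by (auto simp: diff_def flip_def)

lemma diff_flip_less:
  assumes "state X" "state Y" "h \<in> diff X Y"
  shows "card (diff (flip X h) Y) < card (diff X Y)"
proof (rule psubset_card_mono)
  show "finite (diff X Y)" using assms finite_H diff_subset finite_subset by metis
  show "diff (flip X h) Y \<subset> diff X Y"
    using assms(3) diff_tau [OF assms] by (auto simp: diff_def flip_def)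
qed

section \<open>Pairs of states with minimal difference\<close>

lemma diff_commute: "diff X Y = diff Y X"
  by (auto simp: diff_def)

text \<open>Minimality is over all reachable pairs, so it passes to every reachable pair with the
  same difference.\<close>

definition closest :: "('t \<times> nat) set \<Rightarrow> ('t \<times> nat) set \<Rightarrow> bool" where
  "closest X Y \<longleftrightarrow> state X \<and> state Y \<and>
     (\<forall>X' Y'. step\<^sup>*\<^sup>* X X' \<longrightarrow> step\<^sup>*\<^sup>* Y Y' \<longrightarrow> card (diff X Y) \<le> card (diff X' Y'))"

lemma closest_commute: "closest X Y \<Longrightarrow> closest Y X"
  unfolding closest_def using diff_commute by metis

lemma closest_steps:
  "closest X Y \<Longrightarrow> step\<^sup>*\<^sup>* X X' \<Longrightarrow> step\<^sup>*\<^sup>* Y Y' \<Longrightarrow> diff X' Y' = diff X Y \<Longrightarrow> closest X' Y'"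
  unfolding closest_def using steps_state by (metis rtranclp_trans)

lemma closest_not_flippable:
  assumes "closest X Y" "h \<in> diff X Y"
  shows "\<not> state (flip X h)"
proof
  assume st: "state (flip X h)"
  have s: "state X" "state Y" using assms by (auto simp: closest_def)
  then have "h \<in> H" using assms diff_subset by blast
  then have "step\<^sup>*\<^sup>* X (flip X h)" using step_flip s st by blast
  then show False
    using diff_flip_less [OF s assms(2)] assms(1) unfolding closest_def
    by (meson linorder_not_less rtranclp.rtrancl_refl)
qed

lemma closest_stuck:
  assumes "closest X Y" "h \<in> diff X Y"
  shows "special X h \<noteq> special X (\<tau> h)"
    and "\<exists>k\<in>diff X Y. fst k = fst h \<and> k \<noteq> h \<and> special X k \<noteq> special X h"
proof -
  have s: "state X" "state Y" using assms by (auto simp: closest_def)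
  note st = stuck [OF s closest_not_flippable [OF assms(1)] assms(2)]
  show "special X h \<noteq> special X (\<tau> h)" by (rule st)
  show "\<exists>k\<in>diff X Y. fst k = fst h \<and> k \<noteq> h \<and> special X k \<noteq> special X h" by (rule st)
qed

text \<open>The difference contains two half-edges of the triangle of which exactly one is special,
  and a triangle has only one special half-edge.\<close>

lemma closest_outside_not_special:
  assumes "closest X Y" "g \<in> H" "g \<notin> diff X Y" "h \<in> diff X Y" "fst h = fst g"
  shows "\<not> special X g"
proof
  assume sp: "special X g"
  have s: "state X" "state Y" using assms by (auto simp: closest_def)
  obtain k where "k \<in> diff X Y" "fst k = fst h" "special X k \<noteq> special X h"
    using closest_stuck(2) [OF assms(1,4)] by blast
  then show False using sp special_unique assms by metis
qed

text \<open>The conditions on a state treat both bit values alike, and complementation commutes with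
  flips. For branchings this is complete reversal.\<close>

lemma steps_compl:
  assumes "step\<^sup>*\<^sup>* X Y"
  shows "step\<^sup>*\<^sup>* (H - X) (H - Y)"
proof -
  have st: "state (H - X)" if "state X" for X
    using that unfolding state_def by (auto, metis)
  have fl: "flip (H - X) h = H - flip X h" if "h \<in> H" "state X" for X h
    using that tau_H by (auto simp: flip_def state_def)
  show ?thesis using assms
  proof (induction rule: rtranclp_induct)
    case (step Y Z)
    then obtain h where "h \<in> H" "Z = flip Y h" "state Y" "state Z" by (auto simp: step_def)
    then have "step (H - Y) (H - Z)" using st fl by (auto simp: step_def)
    then show ?case using step.IH by simp
  qed simp
qed

text \<open>Flipping at both ends an edge that meets the difference of a closest pair moves the special
  half-edge there, and the pair can stay stuck only if all three edges of one triangle lead to the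
  same triangle.\<close>

lemma closest_flippable_theta:
  assumes cl: "closest X Y" and g: "g \<in> H" "state (flip X g)"
    and h: "h \<in> diff X Y" "fst h = fst g"
  shows "card F = 2" "\<exists>a\<in>H. \<exists>b\<in>H. P a \<noteq> P b" "step (H - X) Y"
proof -
  have s: "state X" "state Y" using cl by (auto simp: closest_def)
  define D where "D = diff X Y"
  have DH: "D \<subseteq> H" using diff_subset s by (simp add: D_def)
  have gD: "g \<notin> D" using closest_not_flippable cl g unfolding D_def by blast
  have tgD: "\<tau> g \<notin> D" using gD diff_tau_iff s g by (simp add: D_def)
  have nsX: "\<not> special X g" "\<not> special X (\<tau> g)" using state_flip_iff s g by auto
  \<comment> \<open>This allows the flip of \<open>g\<close> on \<open>Y\<close> as well. If the
    difference meets the triangle of \<open>k\<close>, the special half-edge lies in the difference;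
    otherwise \<open>X\<close> and \<open>Y\<close> agree there.\<close>
  have nsY: "\<not> special Y k" if k: "k \<in> {g, \<tau> g}" for k
  proof (cases "\<exists>m\<in>D. fst m = fst k")
    case True
    then obtain m where "m \<in> D" "fst m = fst k" by blast
    moreover have "k \<in> H" "k \<notin> D" using k g gD tgD by auto
    ultimately show ?thesis
      using closest_outside_not_special [OF closest_commute [OF cl], of k m] diff_commute [of Y X]
      unfolding D_def by simp
  next
    case False
    then show ?thesis using special_cong [of X Y k] nsX k by (auto simp: D_def)
  qed
  have sY: "state (flip Y g)" using state_flip s g nsY by auto
  define X' where "X' = flip X g"
  define Y' where "Y' = flip Y g"
  have d': "diff X' Y' = D" by (simp add: X'_def Y'_def D_def diff_flip_flip)
  have st: "step X X'" "step Y Y'" using s g sY by (auto simp: step_def X'_def Y'_def)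
  have cl': "closest X' Y'"
    using closest_steps [OF cl] st d' by (auto simp: D_def)
  have stuck1: "special X m \<noteq> special X (\<tau> m)" if "m \<in> D" for m
    using closest_stuck(1) [OF cl] that unfolding D_def by blast
  have stuck2: "special X' m \<noteq> special X' (\<tau> m)" if "m \<in> D" for m
    using closest_stuck(1) [OF cl'] that d' by blast
  obtain k where k: "k \<in> D" "fst k = fst h" "k \<noteq> h" "special X k \<noteq> special X h"
    using closest_stuck(2) [OF cl h(1)] unfolding D_def by blast
  have hD: "h \<in> D" using h by (simp add: D_def)
  have loc: "special X' m \<longleftrightarrow> \<not> special X m" if "m \<in> {h, k}" for m
    using that special_flip [OF s(1) g(1) nsX(1), of m] hD k h(2) DH gD by (auto simp: X'_def)
  \<comment> \<open>Otherwise the flip would change whether \<open>m\<close> is special but not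
    whether \<open>\<tau> m\<close> is, so these could not differ both before and after it.\<close>
  have far: "fst (\<tau> m) = fst (\<tau> g)" if m: "m \<in> {h, k}" for m
  proof (rule ccontr)
    assume ne: "fst (\<tau> m) \<noteq> fst (\<tau> g)"
    have mD: "m \<in> D" "m \<in> H" "fst m = fst g" using m hD k h(2) DH by auto
    then have "special X' (\<tau> m) \<longleftrightarrow> special X (\<tau> m)"
      using special_flip_away [OF g(1), of "\<tau> m"] ne fst_tau_H [of m] by (auto simp: X'_def)
    then show False using stuck1 [OF mD(1)] stuck2 [OF mD(1)] loc [OF m] by auto
  qed
  have gh: "g \<noteq> h" "g \<noteq> k" using gD hD k by auto
  have fibg: "m = g \<or> m = h \<or> m = k" if "m \<in> H" "fst m = fst g" for m
  proof -
    obtain a b where "\<And>m. m \<in> H \<Longrightarrow> fst m = fst g \<Longrightarrow> m = g \<or> m = a \<or> m = b"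
      using fiber [OF g(1)] by metis
    then show ?thesis using that k h(2) hD DH gh by (metis subsetD)
  qed
  have fibt: "m = \<tau> g \<or> m = \<tau> h \<or> m = \<tau> k" if m: "m \<in> H" "fst m = fst (\<tau> g)" for m
  proof -
    obtain a b where ab: "\<And>m. m \<in> H \<Longrightarrow> fst m = fst (\<tau> g) \<Longrightarrow> m = \<tau> g \<or> m = a \<or> m = b"
      using fiber [OF tau_H [OF g(1)]] by metis
    have "h \<in> H" "k \<in> H" using hD k DH by auto
    then have "\<tau> h \<noteq> \<tau> g" "\<tau> k \<noteq> \<tau> g" "\<tau> h \<noteq> \<tau> k" "\<tau> h \<in> H" "\<tau> k \<in> H"
      using gh k(3) g(1) inj_tau unfolding inj_on_def by auto
    then show ?thesis using ab far m by (metis insertCI)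
  qed
  \<comment> \<open>All edges at these two triangles join one to the other, so connectedness leaves
    no third triangle.\<close>
  have FF: "{fst g, fst (\<tau> g)} = F"
  proof (rule connected)
    show "{fst g, fst (\<tau> g)} \<subseteq> F" using g(1) fst_H by auto
    fix m :: "'t \<times> nat" assume "m \<in> F \<times> {..<3}" "fst m \<in> {fst g, fst (\<tau> g)}"
    then have "m \<in> {g, h, k, \<tau> g, \<tau> h, \<tau> k}" using fibg fibt by (auto simp: H_def)
    moreover have "h \<in> H" "k \<in> H" "fst h = fst g" "fst k = fst g" using hD k DH h(2) by auto
    ultimately show "fst (\<tau> m) \<in> {fst g, fst (\<tau> g)}" using far [of h] far [of k] g(1) by auto
  qed simp
  then show "card F = 2" using fst_tau_H [OF g(1)] by (metis card_2_iff)
  have allH: "m \<in> {g, h, k, \<tau> g, \<tau> h, \<tau> k}" if "m \<in> H" for m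
    using that fibg fibt FF fst_H by blast
  \<comment> \<open>If \<open>P\<close> were constant, bits would agree along all edges or along
    none, so the special half-edge \<open>e\<close> would be glued to a special one, against
    \<open>stuck1\<close>.\<close>
  show "\<exists>a\<in>H. \<exists>b\<in>H. P a \<noteq> P b"
  proof (rule ccontr)
    assume c: "\<not> ?thesis"
    obtain e where e: "e \<in> D" "special X e" "fst e = fst g"
      using k h(2) hD by metis
    have eH: "e \<in> H" using e DH by auto
    have "special X (\<tau> e)"
      unfolding special_def
    proof (intro conjI ballI impI)
      fix m assume m: "m \<in> H" "fst m = fst (\<tau> e)" "m \<noteq> \<tau> e"
      have "e = h \<or> e = k" using fibg eH e gD by blast
      then have "m \<in> {\<tau> g, \<tau> h, \<tau> k}" using m fibt far by auto
      then have "fst (\<tau> m) = fst e" using k h(2) hD DH g(1) e(3) by auto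
      moreover have "\<tau> m \<noteq> e" using m by auto
      ultimately have "(\<tau> m \<in> X) \<noteq> (e \<in> X)" using e(2) m unfolding special_def by auto
      moreover have "P m \<longleftrightarrow> P e" using c m(1) eH by blast
      ultimately show "(m \<in> X) \<noteq> (\<tau> e \<in> X)" using s(1) m(1) eH unfolding state_def by blast
    qed (use eH in simp)
    then show False using stuck1 e by blast
  qed
  have HD: "m \<in> D \<longleftrightarrow> m \<noteq> g \<and> m \<noteq> \<tau> g" if "m \<in> H" for m
  proof -
    have "\<tau> h \<in> D" "\<tau> k \<in> D" using hD k diff_tau s by (auto simp: D_def)
    then show ?thesis using allH [OF that] gD tgD hD k by blast
  qed
  \<comment> \<open>The difference is everything except the edge of \<open>g\<close>, so
    \<open>Y\<close> is the complement of \<open>X\<close> up to that edge.\<close>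
  have "Y = flip (H - X) g"
  proof (rule set_eqI)
    fix m
    have "m \<in> D \<longleftrightarrow> (m \<in> X) \<noteq> (m \<in> Y)" by (simp add: D_def diff_def)
    moreover have "X \<subseteq> H" "Y \<subseteq> H" using s by (auto simp: state_def)
    ultimately show "m \<in> Y \<longleftrightarrow> m \<in> flip (H - X) g"
      using HD [of m] g(1) tau_H [OF g(1)] unfolding flip_def by blast
  qed
  moreover have "state (H - X)"
    using s(1) unfolding state_def by (auto, metis)
  ultimately show "step (H - X) Y" using s g by (auto simp: step_def)
qed

text \<open>The exception is the theta graph, two vertices joined by three edges. Without it no flip
  ever occurs at a triangle met by the difference, so every move from \<open>X\<close> can be copied
  on \<open>Y\<close> with the same difference; this contradicts
  \<open>eventually_flippable\<close>.\<close>

lemma closest_eq_or_theta: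
  assumes cl: "closest X Y" and ne: "X \<noteq> Y"
  shows "card F = 2 \<and> (\<exists>a\<in>H. \<exists>b\<in>H. P a \<noteq> P b) \<and> step\<^sup>*\<^sup>* (H - X) Y"
proof (rule ccontr)
  assume no: "\<not> ?thesis"
  have s: "state X" "state Y" using cl by (auto simp: closest_def)
  have nf: "\<not> state (flip X' g)"
    if r: "step\<^sup>*\<^sup>* X X'" "step\<^sup>*\<^sup>* Y Y'" "diff X' Y' = diff X Y" and g: "g \<in> H" "fst g \<in> fst ` diff X Y"
    for X' Y' g
  proof
    assume st: "state (flip X' g)"
    obtain h where "h \<in> diff X' Y'" "fst h = fst g" using g r(3) by force
    note theta = closest_flippable_theta [OF closest_steps [OF cl r] g(1) st this]
    \<comment> \<open>The path runs from \<open>H - X\<close> to \<open>H - X'\<close>, then to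
      \<open>Y'\<close>, and back to \<open>Y\<close>.\<close>
    have "step\<^sup>*\<^sup>* (H - X) Y"
      using steps_compl [OF r(1)] theta(3) steps_sym [OF r(2)]
      by (meson rtranclp.rtrancl_into_rtrancl rtranclp_trans)
    then show False using no theta by blast
  qed
  have joint: "\<exists>Y'. step\<^sup>*\<^sup>* Y Y' \<and> diff X' Y' = diff X Y" if "step\<^sup>*\<^sup>* X X'" for X'
    using that
  proof (induction rule: rtranclp_induct)
    case (step X1 X2)
    then obtain Y1 where Y1: "step\<^sup>*\<^sup>* Y Y1" "diff X1 Y1 = diff X Y" by blast
    obtain g where g: "g \<in> H" "X2 = flip X1 g" "state X1" "state X2"
      using step.hyps by (auto simp: step_def)
    have sY1: "state Y1" using Y1 s steps_state by blast
    have away: "fst k \<noteq> fst g" "fst k \<noteq> fst (\<tau> g)" if "k \<in> diff X Y" for k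
      using nf [OF step.hyps(1) Y1] g flip_tau tau_H that by (metis image_eqI)+
    have "state (flip Y1 g)"
      using special_cong [of X1 Y1] away Y1(2) state_flip_iff g sY1 by metis
    then have "step Y1 (flip Y1 g)" using sY1 g by (auto simp: step_def)
    then show ?case
      using Y1 g diff_flip_flip by (metis rtranclp.rtrancl_into_rtrancl)
  qed auto
  obtain h where h: "h \<in> diff X Y" using ne by (auto simp: diff_def)
  then have "fst h \<in> F" using diff_subset s fst_H by blast
  then obtain X' g where "step\<^sup>*\<^sup>* X X'" "g \<in> H" "fst g = fst h" "state (flip X' g)"
    using eventually_flippable s by metis
  then show False using nf joint h by (metis image_eqI)
qed

text \<open>A reachable pair with smallest difference is closest; moves are reversible and commute
  with complementation, so the result for that pair carries back to \<open>X\<close> and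
  \<open>Y\<close>.\<close>

theorem steps_or_theta:
  assumes "state X" "state Y"
  shows "step\<^sup>*\<^sup>* X Y \<or>
    card F = 2 \<and> (\<exists>a\<in>H. \<exists>b\<in>H. P a \<noteq> P b) \<and> step\<^sup>*\<^sup>* (H - X) Y"
proof -
  define R where "R = (\<lambda>(X', Y'). step\<^sup>*\<^sup>* X X' \<and> step\<^sup>*\<^sup>* Y Y')"
  have "R (X, Y)" by (simp add: R_def)
  then obtain p where p: "R p" "\<And>q. R q \<Longrightarrow> card (diff (fst p) (snd p)) \<le> card (diff (fst q) (snd q))"
    using ex_has_least_nat [of R "(X, Y)" "\<lambda>q. card (diff (fst q) (snd q))"] by blast
  obtain X' Y' where p': "p = (X', Y')" by fastforce
  have r: "step\<^sup>*\<^sup>* X X'" "step\<^sup>*\<^sup>* Y Y'" using p(1) by (auto simp: R_def p')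
  have "closest X' Y'"
    unfolding closest_def
  proof (intro conjI allI impI)
    fix X1 Y1 assume "step\<^sup>*\<^sup>* X' X1" "step\<^sup>*\<^sup>* Y' Y1"
    then have "R (X1, Y1)" using r by (auto simp: R_def)
    then show "card (diff X' Y') \<le> card (diff X1 Y1)" using p(2) by (force simp: p')
  qed (use r assms steps_state in blast)+
  then consider "X' = Y'" |
    "card F = 2" "\<exists>a\<in>H. \<exists>b\<in>H. P a \<noteq> P b" "step\<^sup>*\<^sup>* (H - X') Y'"
    using closest_eq_or_theta by blast
  then show ?thesis
  proof cases
    case 1
    then show ?thesis using r steps_sym by (meson rtranclp_trans)
  next
    case 2
    then show ?thesis using steps_compl r steps_sym by (meson rtranclp_trans)
  qed
qed

end

section \<open>From branchings to states\<close>

text \<open>The half-edge (t, i) stands for the abstract edge of t joining the corners i and i + 1 mod 3,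
  canonically directed from the former to the latter.\<close>

definition dir :: "'t \<times> nat \<Rightarrow> 't dedge" where
  "dir h = (fst h, snd h, (snd h + 1) mod 3)"

text \<open>For distinct corners, if \<open>b\<close> is not the successor of \<open>a\<close>
  modulo 3, then \<open>a\<close> is the successor of \<open>b\<close>, and the canonical direction
  starts at \<open>b\<close>.\<close>

definition und :: "'t dedge \<Rightarrow> 't \<times> nat" where
  "und = (\<lambda>(t, a, b). (t, if b = (a + 1) mod 3 then a else b))"

definition glue :: "('t dedge \<Rightarrow> 't dedge) \<Rightarrow> 't \<times> nat \<Rightarrow> 't \<times> nat" where
  "glue \<sigma> h = und (\<sigma> (dir h))"

definition keeps_dir :: "('t dedge \<Rightarrow> 't dedge) \<Rightarrow> 't \<times> nat \<Rightarrow> bool" where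
  "keeps_dir \<sigma> h \<longleftrightarrow> \<sigma> (dir h) = dir (glue \<sigma> h)"

definition orientation_of :: "'t set \<Rightarrow> ('t \<times> nat) set \<Rightarrow> 't dedge set" where
  "orientation_of F X = {d\<in>dedges F. dir (und d) = d \<longleftrightarrow> und d \<in> X}"

lemma less_3_cases: "(a::nat) < 3 \<Longrightarrow> (a = 0 \<Longrightarrow> Q) \<Longrightarrow> (a = 1 \<Longrightarrow> Q) \<Longrightarrow> (a = 2 \<Longrightarrow> Q) \<Longrightarrow> Q"
  by linarith

lemma rev_de_rev_de [simp]: "rev_de (rev_de d) = d"
  by (cases d) (simp add: rev_de_def)

lemma rev_de_in [simp]: "rev_de d \<in> dedges F \<longleftrightarrow> d \<in> dedges F"
  by (cases d) (auto simp: rev_de_def dedges_def)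

lemma fst_und [simp]: "fst (und d) = fst d"
  by (cases d) (simp add: und_def)

lemma rev_de_neq: "d \<in> dedges F \<Longrightarrow> rev_de d \<noteq> d"
  by (cases d) (auto simp: rev_de_def dedges_def)

lemma und_dir: "h \<in> F \<times> {..<3} \<Longrightarrow> und (dir h) = h"
  by (cases h) (simp add: und_def dir_def)

lemma dir_in: "h \<in> F \<times> {..<3} \<Longrightarrow> dir h \<in> dedges F"
  by (cases h) (auto simp: dir_def dedges_def elim: less_3_cases)

lemma und_in: "d \<in> dedges F \<Longrightarrow> und d \<in> F \<times> {..<3}"
  by (cases d) (auto simp: und_def dedges_def)

lemma und_rev_de: "d \<in> dedges F \<Longrightarrow> und (rev_de d) = und d"
  by (cases d) (auto simp: und_def dedges_def rev_de_def elim!: less_3_cases)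

lemma dir_und: "d \<in> dedges F \<Longrightarrow> d = dir (und d) \<or> d = rev_de (dir (und d))"
  by (cases d) (auto simp: und_def dir_def dedges_def rev_de_def elim!: less_3_cases)

lemma dir_in_orientation:
  "h \<in> F \<times> {..<3} \<Longrightarrow> dir h \<in> orientation_of F X \<longleftrightarrow> h \<in> X"
  by (simp add: orientation_of_def dir_in und_dir)

lemma rev_dir_in_orientation:
  assumes "h \<in> F \<times> {..<3}"
  shows "rev_de (dir h) \<in> orientation_of F X \<longleftrightarrow> h \<notin> X"
  using assms rev_de_neq [OF dir_in [OF assms]] und_rev_de [OF dir_in [OF assms]]
  by (auto simp: orientation_of_def dir_in und_dir)

text \<open>The rank of a corner is its number of smaller corners.\<close>

lemma acyclic_triangle_ranked:
  fixes p :: "nat \<Rightarrow> bool"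
  assumes "i < 3" "j < 3" "p i" "\<not> p j"
  shows "\<exists>r :: nat \<Rightarrow> nat. \<forall>a<3. \<forall>b<3. a \<noteq> b \<longrightarrow>
    ((if b = (a + 1) mod 3 then p a else \<not> p b) \<longleftrightarrow> r a < r b)"
proof -
  have "\<not> (p 0 = p 1 \<and> p 1 = p 2)"
    using assms by (auto elim!: less_3_cases)
  then show ?thesis
    \<comment> \<open>The summands record whether the edge from the preceding corner and the edge to
      the following corner point to \<open>a\<close>.\<close>
    by (intro exI [of _ "\<lambda>a. of_bool (p ((a + 2) mod 3)) + of_bool (\<not> p a)"] allI impI)
      (auto elim!: less_3_cases simp: numeral_2_eq_2)
qed

section \<open>The dual graph of a gluing without trapped edges\<close>

locale glued_triangles =
  fixes F :: "'t set" and \<sigma> :: "'t dedge \<Rightarrow> 't dedge"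
  assumes fin: "finite F" and gluing: "is_gluing F \<sigma>" and conn: "glued_connected F \<sigma>"
    and untrapped: "\<forall>e\<in>tri_edges F \<sigma>. \<not> trapped F \<sigma> e"
begin

lemma sigma:
  assumes "d \<in> dedges F"
  shows "\<sigma> d \<in> dedges F" "\<sigma> (\<sigma> d) = d" "\<sigma> (rev_de d) = rev_de (\<sigma> d)"
  using gluing assms by (auto simp: is_gluing_def)

lemma fst_sigma: "d \<in> dedges F \<Longrightarrow> fst (\<sigma> d) \<noteq> fst d"
  using untrapped by (auto simp: tri_edges_def trapped_def edge_class_def)

lemma glue_in: "h \<in> F \<times> {..<3} \<Longrightarrow> glue \<sigma> h \<in> F \<times> {..<3}"
  unfolding glue_def by (intro und_in sigma dir_in)

lemma fst_glue: "h \<in> F \<times> {..<3} \<Longrightarrow> fst (glue \<sigma> h) \<noteq> fst h"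
  using fst_sigma [OF dir_in] by (simp add: glue_def) (simp add: dir_def)

lemma sigma_dir:
  "h \<in> F \<times> {..<3} \<Longrightarrow>
    \<sigma> (dir h) = (if keeps_dir \<sigma> h then dir (glue \<sigma> h) else rev_de (dir (glue \<sigma> h)))"
  using dir_und [OF sigma(1) [OF dir_in]] by (auto simp: keeps_dir_def glue_def)

text \<open>The gluing commutes with reversal, so it descends to undirected abstract edges.\<close>

lemma und_sigma:
  assumes "d \<in> dedges F"
  shows "und (\<sigma> d) = glue \<sigma> (und d)"
proof -
  note h = und_in [OF assms]
  show ?thesis
    using dir_und [OF assms] sigma(3) [OF dir_in [OF h]] und_rev_de [OF sigma(1) [OF dir_in [OF h]]]
    unfolding glue_def by metis
qed

lemma glue_glue: "h \<in> F \<times> {..<3} \<Longrightarrow> glue \<sigma> (glue \<sigma> h) = h"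
  using und_sigma [OF sigma(1) [OF dir_in, of h]] sigma(2) [OF dir_in, of h] und_dir [of h]
  by (metis glue_def)

text \<open>This is the dual graph: cubic because triangles have three edges, loopless because no
  edge is trapped, connected because the surface is.\<close>

sublocale signed_cubic_graph F "glue \<sigma>" "keeps_dir \<sigma>"
proof
  show "finite F" by (rule fin)
  fix Z assume Z: "Z \<subseteq> F" "Z \<noteq> {}"
    and closed: "\<And>h. h \<in> F \<times> {..<3} \<Longrightarrow> fst h \<in> Z \<Longrightarrow> fst (glue \<sigma> h) \<in> Z"
  obtain z where z: "z \<in> Z" using Z by blast
  have "t \<in> Z" if "(dual_adj F \<sigma>)\<^sup>*\<^sup>* z t" for t
    using that
  proof (induction rule: rtranclp_induct)
    case (step t u)
    then obtain d where d: "d \<in> dedges F" "fst d = t" "fst (\<sigma> d) = u" by (auto simp: dual_adj_def)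
    then show ?case
      using closed [OF und_in [OF d(1)]] und_sigma [OF d(1)] step.IH by (metis fst_und)
  qed (rule z)
  then show "Z = F" using conn z Z(1) unfolding glued_connected_def by blast
qed (fact glue_in glue_glue fst_glue)+

text \<open>The sign condition gives compatibility with the gluing, and unequal bits at a triangle
  give a ranking of its corners.\<close>

lemma branching_orientation:
  assumes X: "state X"
  shows "branching F \<sigma> (orientation_of F X)"
proof -
  let ?B = "orientation_of F X"
  have rev: "d \<in> ?B \<longleftrightarrow> rev_de d \<notin> ?B" if d: "d \<in> dedges F" for d
    using dir_und [OF d] dir_in_orientation [OF und_in [OF d]] rev_dir_in_orientation [OF und_in [OF d]]
    by (metis rev_de_rev_de)
  have dir: "dir h \<in> ?B \<longleftrightarrow> \<sigma> (dir h) \<in> ?B" if h: "h \<in> F \<times> {..<3}" for h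
  proof -
    have "(h \<in> X \<longleftrightarrow> glue \<sigma> h \<in> X) \<longleftrightarrow> keeps_dir \<sigma> h"
      using X h unfolding state_def H_def by blast
    then show ?thesis
      by (auto simp: sigma_dir [OF h] dir_in_orientation [OF h] dir_in_orientation [OF glue_in [OF h]]
        rev_dir_in_orientation [OF glue_in [OF h]])
  qed
  \<comment> \<open>Reversal commutes with \<open>\<sigma>\<close> and exchanges chosen and unchosen
    directions, so the canonical directions suffice.\<close>
  have sig: "d \<in> ?B \<longleftrightarrow> \<sigma> d \<in> ?B" if d: "d \<in> dedges F" for d
    using dir_und [OF d] dir [OF und_in [OF d]] rev [OF dir_in [OF und_in [OF d]]]
      rev [OF sigma(1) [OF dir_in [OF und_in [OF d]]]] sigma(3) [OF dir_in [OF und_in [OF d]]]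
    by metis
  have "\<exists>r :: nat \<Rightarrow> nat. \<forall>a<3. \<forall>b<3. a \<noteq> b \<longrightarrow> ((t, a, b) \<in> ?B \<longleftrightarrow> r a < r b)" if t: "t \<in> F" for t
  proof -
    obtain i j where "i < 3" "j < 3" "(t, i) \<in> X" "(t, j) \<notin> X"
      using X t unfolding state_def H_def by fastforce
    note acyclic_triangle_ranked [of i j "\<lambda>i. (t, i) \<in> X", OF this]
    moreover have "(t, a, b) \<in> ?B \<longleftrightarrow> (if b = (a + 1) mod 3 then (t, a) \<in> X else (t, b) \<notin> X)"
      if "a < 3" "b < 3" "a \<noteq> b" for a b
      using that t by (auto simp: orientation_of_def dedges_def und_def dir_def)
    ultimately show ?thesis by auto
  qed
  moreover have "?B \<subseteq> dedges F" by (auto simp: orientation_of_def)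
  ultimately show ?thesis
    using rev sig unfolding branching_def by blast
qed

lemma orientation_of_branching:
  assumes B: "branching F \<sigma> B"
  obtains X where "state X" "orientation_of F X = B"
proof
  let ?X = "{h \<in> H. dir h \<in> B}"
  have rev: "\<And>d. d \<in> dedges F \<Longrightarrow> d \<in> B \<longleftrightarrow> rev_de d \<notin> B"
    and sig: "\<And>d. d \<in> dedges F \<Longrightarrow> d \<in> B \<longleftrightarrow> \<sigma> d \<in> B" and sub: "B \<subseteq> dedges F"
    using B unfolding branching_def by blast+
  show "orientation_of F ?X = B"
  proof (rule set_eqI)
    fix d
    show "d \<in> orientation_of F ?X \<longleftrightarrow> d \<in> B"
    proof (cases "d \<in> dedges F")
      case True
      then obtain h where h: "h \<in> F \<times> {..<3}" "d = dir h \<or> d = rev_de (dir h)"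
        using und_in dir_und by blast
      have "h \<in> ?X \<longleftrightarrow> dir h \<in> B" using h by (simp add: H_def)
      then show ?thesis
        using h(2) rev [OF dir_in [OF h(1)]] dir_in_orientation [OF h(1), of ?X]
          rev_dir_in_orientation [OF h(1), of ?X] by blast
    qed (use sub in \<open>auto simp: orientation_of_def\<close>)
  qed
  have P: "(h \<in> ?X \<longleftrightarrow> glue \<sigma> h \<in> ?X) \<longleftrightarrow> keeps_dir \<sigma> h" if h: "h \<in> H" for h
  proof -
    have hF: "h \<in> F \<times> {..<3}" using h unfolding H_def .
    have "dir h \<in> B \<longleftrightarrow> (if keeps_dir \<sigma> h then dir (glue \<sigma> h) \<in> B else dir (glue \<sigma> h) \<notin> B)"
      using sig [OF dir_in [OF hF]] rev [OF dir_in [OF glue_in [OF hF]]] sigma_dir [OF hF] by presburger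
    then show ?thesis using h tau_H [OF h] by (simp split: if_splits)
  qed
  have "\<exists>h\<in>H. \<exists>k\<in>H. fst h = t \<and> fst k = t \<and> h \<in> ?X \<and> k \<notin> ?X" if t: "t \<in> F" for t
  proof -
    obtain r :: "nat \<Rightarrow> nat"
      where r: "\<forall>a<3. \<forall>b<3. a \<noteq> b \<longrightarrow> ((t, a, b) \<in> B \<longleftrightarrow> r a < r b)"
      using B t unfolding branching_def by blast
    have tH: "(t, i) \<in> H" if "i < 3" for i using that t by (simp add: H_def)
    have d: "dir (t, 0) = (t, 0, 1)" "dir (t, 1) = (t, 1, 2)" "dir (t, 2) = (t, 2, 0)"
      by (simp_all add: dir_def numeral_2_eq_2)
    have ra: "(t, a, b) \<in> B \<longleftrightarrow> r a < r b" if "a < 3" "b < 3" "a \<noteq> b" for a b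
      using r that by blast
    have "dir (t, 0) \<in> B \<longleftrightarrow> r 0 < r 1" "dir (t, 1) \<in> B \<longleftrightarrow> r 1 < r 2" "dir (t, 2) \<in> B \<longleftrightarrow> r 2 < r 0"
      unfolding d by (rule ra; simp)+
    \<comment> \<open>With equal ranks neither direction of the edge would be in
      \<open>B\<close>.\<close>
    moreover have "r a \<noteq> r b" if "a < 3" "b < 3" "a \<noteq> b" for a b
      using rev [of "(t, a, b)"] ra [of a b] ra [of b a] that t by (auto simp: dedges_def rev_de_def)
    then have "r 0 \<noteq> r 1" "r 1 \<noteq> r 2" "r 0 \<noteq> r 2" by simp_all
    then have "r 0 < r 1 \<or> r 1 < r 2 \<or> r 2 < r 0" "\<not> (r 0 < r 1 \<and> r 1 < r 2 \<and> r 2 < r 0)"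
      by linarith+
    moreover have "(0::nat) < 3" "(1::nat) < 3" "(2::nat) < 3" by simp_all
    ultimately have "\<exists>i<3. \<exists>j<3. dir (t, i) \<in> B \<and> dir (t, j) \<notin> B" by metis
    then show ?thesis using tH by (metis (mono_tags, lifting) fst_conv mem_Collect_eq)
  qed
  then show "state ?X" using P unfolding state_def by blast
qed

lemma mem_edge_class:
  assumes "d \<in> dedges F"
  shows "edge_class \<sigma> d = {d' \<in> dedges F. und d' = und d \<or> und d' = glue \<sigma> (und d)}"
proof -
  have same: "d1 = d2 \<or> d1 = rev_de d2" if "d1 \<in> dedges F" "d2 \<in> dedges F" "und d1 = und d2" for d1 d2
    using dir_und [OF that(1)] dir_und [OF that(2)] that(3) by (metis rev_de_rev_de)
  note d = assms sigma(1) [OF assms]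
  show ?thesis (is "_ = ?R")
  proof
    show "edge_class \<sigma> d \<subseteq> ?R"
      using d und_rev_de [OF d(1)] und_rev_de [OF d(2)] und_sigma [OF assms]
      by (simp add: edge_class_def)
    show "?R \<subseteq> edge_class \<sigma> d"
    proof
      fix e assume "e \<in> ?R"
      then have e: "e \<in> dedges F" "und e = und d \<or> und e = und (\<sigma> d)"
        by (simp_all add: und_sigma [OF assms])
      show "e \<in> edge_class \<sigma> d"
        using e(2) same [OF e(1) d(1)] same [OF e(1) d(2)] by (auto simp: edge_class_def)
    qed
  qed
qed

text \<open>Toggling the bits of \<open>h\<close> and \<open>glue \<sigma> h\<close> reverses
  exactly the directed edges in one class, as \<open>mem_edge_class\<close> describes it.\<close>

lemma inversion_step_orientation:
  assumes "step X Y"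
  shows "inversion_step F \<sigma> (orientation_of F X) (orientation_of F Y)"
proof -
  obtain h where h: "h \<in> F \<times> {..<3}" "Y = flip X h" "state X" "state Y"
    using assms by (auto simp: step_def H_def)
  let ?e = "edge_class \<sigma> (dir h)"
  have e: "?e = {d \<in> dedges F. und d = h \<or> und d = glue \<sigma> h}"
    using mem_edge_class [OF dir_in [OF h(1)]] und_dir [OF h(1)] by simp
  have eq: "orientation_of F Y = reverse_edge (orientation_of F X) ?e"
    unfolding e h(2) by (auto simp: orientation_of_def flip_def reverse_edge_def)
  have "?e \<in> tri_edges F \<sigma>" unfolding tri_edges_def using dir_in [OF h(1)] by (rule imageI)
  then show ?thesis
    using eq branching_orientation [OF h(4)] untrapped
    unfolding inversion_step_def ambiguous_def by auto
qed

lemma inversion_connected_orientation: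
  "step\<^sup>*\<^sup>* X Y \<Longrightarrow> inversion_connected F \<sigma> (orientation_of F X) (orientation_of F Y)"
  unfolding inversion_connected_def
  by (induction rule: rtranclp_induct)
    (auto intro: rtranclp.rtrancl_into_rtrancl inversion_step_orientation)

lemma neg_branching_orientation: "neg_branching F (orientation_of F X) = orientation_of F (H - X)"
  using und_in by (auto simp: neg_branching_def orientation_of_def H_def)

section \<open>The exceptional case of two triangles\<close>

lemma orientable_two_triangles:
  assumes "glued_orientable F \<sigma>" "card F = 2" "a \<in> H" "b \<in> H"
  shows "keeps_dir \<sigma> a \<longleftrightarrow> keeps_dir \<sigma> b"
proof -
  obtain \<epsilon> where \<epsilon>: "\<And>d. d \<in> dedges F \<Longrightarrow> agrees \<epsilon> d \<noteq> agrees \<epsilon> (\<sigma> d)"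
    using assms(1) by (auto simp: glued_orientable_def)
  have agr: "agrees \<epsilon> (dir h) \<longleftrightarrow> \<epsilon> (fst h)" "agrees \<epsilon> (rev_de (dir h)) \<longleftrightarrow> \<not> \<epsilon> (fst h)"
    if "h \<in> F \<times> {..<3}" for h
    using that by (auto simp: agrees_def dir_def rev_de_def elim!: less_3_cases)
  obtain v w where F: "F = {v, w}" "v \<noteq> w" using assms(2) by (meson card_2_iff)
  \<comment> \<open>Canonical directions are preserved exactly when the two triangles carry
    different orientation bits, and every edge joins the same two triangles.\<close>
  have "keeps_dir \<sigma> h \<longleftrightarrow> \<epsilon> v \<noteq> \<epsilon> w" if "h \<in> H" for h
  proof -
    have h: "h \<in> F \<times> {..<3}" using that by (simp add: H_def)
    have "keeps_dir \<sigma> h \<longleftrightarrow> \<epsilon> (fst h) \<noteq> \<epsilon> (fst (glue \<sigma> h))"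
      using \<epsilon> [OF dir_in [OF h]] sigma_dir [OF h] agr [OF h] agr [OF glue_in [OF h]]
      by (auto split: if_splits)
    moreover have "fst h \<in> F" "fst (glue \<sigma> h) \<in> F" "fst (glue \<sigma> h) \<noteq> fst h"
      using that by (auto intro: fst_H)
    ultimately show ?thesis using F by auto
  qed
  then show ?thesis using assms(3,4) by simp
qed

text \<open>Every edge has a side in the first triangle, so there are at most three edges; with at
  least one vertex this gives \<open>1 - 3 + 2 = 0\<close> as a lower bound.\<close>

lemma euler_char_two_triangles:
  assumes "card F = 2"
  shows "euler_char F \<sigma> \<ge> 0"
proof -
  obtain v w where F: "F = {v, w}" "v \<noteq> w" using assms by (meson card_2_iff)
  let ?cls = "\<lambda>h. {d \<in> dedges F. und d = h \<or> und d = glue \<sigma> h}"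
  have "tri_edges F \<sigma> \<subseteq> ?cls ` ({v} \<times> {..<3})"
  proof
    fix e assume "e \<in> tri_edges F \<sigma>"
    then obtain d where d: "d \<in> dedges F" "e = edge_class \<sigma> d" by (auto simp: tri_edges_def)
    define h where "h = und d"
    have h: "h \<in> F \<times> {..<3}" using und_in [OF d(1)] by (simp add: h_def)
    have e: "e = ?cls h" using mem_edge_class d by (simp add: h_def)
    then have e': "e = ?cls (glue \<sigma> h)" using glue_glue [OF h] by auto
    have "h \<in> {v} \<times> {..<3} \<or> glue \<sigma> h \<in> {v} \<times> {..<3}"
      using h glue_in [OF h] fst_glue [OF h] F by auto
    then show "e \<in> ?cls ` ({v} \<times> {..<3})"
      using imageI [of h _ ?cls] imageI [of "glue \<sigma> h" _ ?cls] unfolding e [symmetric] e' [symmetric]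
      by (elim disjE)
  qed
  then have "card (tri_edges F \<sigma>) \<le> card ({v} \<times> {..<3::nat})"
    by (meson card_image_le card_mono finite_SigmaI finite.emptyI finite_imageI finite_insert
      finite_lessThan le_trans)
  then have edges: "card (tri_edges F \<sigma>) \<le> 3" by (simp add: card_cartesian_product)
  have "corners F = F \<times> {..<3}" by (auto simp: corners_def)
  then have "finite (corners F)" "(v, 0) \<in> corners F" using F by auto
  then have "finite (tri_vertices F \<sigma>)" "tri_vertices F \<sigma> \<noteq> {}"
    unfolding tri_vertices_def quotient_def by auto
  then have "card (tri_vertices F \<sigma>) \<ge> 1" by (simp add: Suc_leI card_gt_0_iff)
  then show ?thesis using edges assms by (simp add: euler_char_def)
qed

lemma branchings_connected:
  assumes "branching F \<sigma> B" "branching F \<sigma> B'"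
  shows "inversion_connected F \<sigma> B B' \<or>
    \<not> glued_orientable F \<sigma> \<and> euler_char F \<sigma> \<ge> 0 \<and> inversion_connected F \<sigma> (neg_branching F B) B'"
proof -
  obtain X where X: "state X" "orientation_of F X = B" using orientation_of_branching assms(1) .
  obtain Y where Y: "state Y" "orientation_of F Y = B'" using orientation_of_branching assms(2) .
  consider "step\<^sup>*\<^sup>* X Y" |
    a b where "card F = 2" "a \<in> H" "b \<in> H" "keeps_dir \<sigma> a \<noteq> keeps_dir \<sigma> b" "step\<^sup>*\<^sup>* (H - X) Y"
    using steps_or_theta [OF X(1) Y(1)] by blast
  then show ?thesis
  proof cases
    case 1
    then show ?thesis using inversion_connected_orientation X Y by blast
  next
    case 2
    then show ?thesis
      using inversion_connected_orientation [OF 2(5)] neg_branching_orientation [of X] X Y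
        orientable_two_triangles [OF _ 2(1-3)] euler_char_two_triangles by auto
  qed
qed

end

theorem theorem3p2:
  fixes F :: "'t set" and \<sigma> :: "'t dedge \<Rightarrow> 't dedge"
  assumes "finite F"
    and "is_gluing F \<sigma>"
    and "glued_connected F \<sigma>"
    and "euler_char F \<sigma> - int (card (tri_vertices F \<sigma>)) < 0"
    and "\<forall>e\<in>tri_edges F \<sigma>. \<not> trapped F \<sigma> e"
  shows "(glued_orientable F \<sigma> \<or>
            (\<not> glued_orientable F \<sigma> \<and> even (euler_char F \<sigma>) \<and> euler_char F \<sigma> < 0)
           \<longrightarrow> (\<forall>B B'. branching F \<sigma> B \<and> branching F \<sigma> B' \<longrightarrow> inversion_connected F \<sigma> B B'))
       \<and> (\<not> glued_orientable F \<sigma> \<and> (euler_char F \<sigma> = 0 \<or> odd (euler_char F \<sigma>))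
           \<longrightarrow> (\<forall>B B'. branching F \<sigma> B \<and> branching F \<sigma> B' \<longrightarrow>
                 inversion_connected F \<sigma> B B' \<or> inversion_connected F \<sigma> (neg_branching F B) B'))"
proof -
  interpret glued_triangles F \<sigma>
    using assms by unfold_locales
  \<comment> \<open>The exception requires a non-orientable surface of nonnegative Euler
    characteristic, which the first clause excludes; the second clause admits both
    alternatives.\<close>
  show ?thesis using branchings_connected by (meson not_less)
qed

end
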